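(* Let $n\ge 1$. For $\pi\in\mathcal S_n(321)$ let $\mathrm{fp}(\pi)=|\{i:\pi(i)=i\}|$ be the number of fixed points of $\pi$. Then the statistic $\mathrm{fp}$ is $1$-mesic under the action of rowmotion $\rho_{\mathcal S}$ on $\mathcal S_n(321)$; that is, for every orbit $\mathcal O$ of $\rho_{\mathcal S}$ on $\mathcal S_n(321)$, $\frac{1}{|\mathcal O|}\sum_{\pi\in\mathcal O}\mathrm{fp}(\pi)=1$.
   Context: $\mathcal S_n(321)$ is the set of permutations $\pi$ of $\{1,\dots,n\}$ that are $321$-avoiding: there are no $i<j<k$ with $\pi(i)>\pi(j)>\pi(k)$. $\mathbf A^{n-1}$ is the poset of intervals $\{[i,j]:1\le i\le j\le n-1\}$ ordered by inclusion (type $A$ positive root poset), and $\mathcal A(\mathbf A^{n-1})$ is its set of antichains. Antichain rowmotion $\rho_{\mathcal A}:\mathcal A(\mathbf A^{n-1})\to\mathcal A(\mathbf A^{n-1})$ sends an antichain $A$ to the set of minimal elements of the complement of the order ideal $\{x: x\le y\text{ for some }y\in A\}$ generated by $A$; it is a bijection. The map $\mathrm{Exc}:\mathcal S_n(321)\to\mathcal A(\mathbf A^{n-1})$, $\mathrm{Exc}(\pi)=\{[i,\pi(i)-1]:\pi(i)>i\}$, is a bijection. Rowmotion on $321$-avoiding permutations is $\rho_{\mathcal S}=\mathrm{Exc}^{-1}\circ\rho_{\mathcal A}\circ\mathrm{Exc}$. *)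

theory Defs
  imports Complex_Main "HOL-Combinatorics.Permutations" "HOL-Combinatorics.Orbits"
begin

text \<open>
  Permutations of \<open>{1..n}\<close> are functions on \<^typ>\<open>nat\<close> with
  \<open>\<pi> permutes {1..n}\<close>; in particular they are the identity outside \<open>{1..n}\<close>.
\<close>

definition avoids_321 :: "nat \<Rightarrow> (nat \<Rightarrow> nat) \<Rightarrow> bool" where
  "avoids_321 n \<pi> \<longleftrightarrow>
     \<not> (\<exists>i\<in>{1..n}. \<exists>j\<in>{1..n}. \<exists>k\<in>{1..n}. i < j \<and> j < k \<and> \<pi> i > \<pi> j \<and> \<pi> j > \<pi> k)"

definition S321 :: "nat \<Rightarrow> (nat \<Rightarrow> nat) set" where
  "S321 n = {\<pi>. \<pi> permutes {1..n} \<and> avoids_321 n \<pi>}"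

text \<open>
  The type \<open>A\<close> positive root poset \<open>\<^bold>A\<^sup>m\<close>: its elements are the nonempty
  intervals as sets of naturals, so that its order is \<open>(\<subseteq>)\<close>.
\<close>

definition root_poset :: "nat \<Rightarrow> nat set set" where
  "root_poset m = {{i..j} | i j. 1 \<le> i \<and> i \<le> j \<and> j \<le> m}"

definition antichains :: "'a set set \<Rightarrow> 'a set set set" where
  "antichains P = {A. A \<subseteq> P \<and> (\<forall>x\<in>A. \<forall>y\<in>A. x \<subseteq> y \<longrightarrow> x = y)}"

definition order_ideal :: "'a set set \<Rightarrow> 'a set set \<Rightarrow> 'a set set" where
  "order_ideal P A = {x \<in> P. \<exists>y\<in>A. x \<subseteq> y}"

definition minimal_elements :: "'a set set \<Rightarrow> 'a set set" where
  "minimal_elements X = {x \<in> X. \<forall>y\<in>X. y \<subseteq> x \<longrightarrow> y = x}"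

definition antichain_rowmotion :: "'a set set \<Rightarrow> 'a set set \<Rightarrow> 'a set set" where
  "antichain_rowmotion P A = minimal_elements (P - order_ideal P A)"

definition Exc :: "nat \<Rightarrow> (nat \<Rightarrow> nat) \<Rightarrow> nat set set" where
  "Exc n \<pi> = {{i..\<pi> i - 1} | i. i \<in> {1..n} \<and> \<pi> i > i}"

text \<open>
  \<open>Exc n\<close> is a bijection from \<open>S321 n\<close> onto \<open>antichains (root_poset (n - 1))\<close>, and
  antichain rowmotion maps the latter set to itself, so on \<open>S321 n\<close> the use of
  \<^const>\<open>inv_into\<close> below denotes the genuine inverse of \<open>Exc n\<close>.
\<close>

definition rowmotion :: "nat \<Rightarrow> (nat \<Rightarrow> nat) \<Rightarrow> (nat \<Rightarrow> nat)" where
  "rowmotion n \<pi> =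
     inv_into (S321 n) (Exc n) (antichain_rowmotion (root_poset (n - 1)) (Exc n \<pi>))"

definition fp :: "nat \<Rightarrow> (nat \<Rightarrow> nat) \<Rightarrow> nat" where
  "fp n \<pi> = card {i \<in> {1..n}. \<pi> i = i}"

text \<open>
  A statistic \<open>st\<close> is \<open>c\<close>-mesic under \<open>f\<close> acting on \<open>X\<close> if its average over every orbit
  is \<open>c\<close>. The library's \<^term>\<open>orbit f x\<close> consists of the iterates of \<open>x\<close> under \<open>f\<close> with
  positive exponent; for a bijection \<open>f\<close> of a finite set \<open>X\<close> this is the usual orbit.
\<close>

definition mesic :: "real \<Rightarrow> ('a \<Rightarrow> real) \<Rightarrow> ('a \<Rightarrow> 'a) \<Rightarrow> 'a set \<Rightarrow> bool" where
  "mesic c st f X \<longleftrightarrow>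
     (\<forall>Orb \<in> orbit f ` X. (\<Sum>x\<in>Orb. st x) / real (card Orb) = c)"

end

theory Submission
  imports Defs "HOL-Library.Infinite_Set"
begin

text \<open>
  A permutation avoiding 321 satisfies \<open>\<pi> i \<ge> i\<close> exactly when \<open>\<pi> i\<close> is a left-to-right
  maximum. With \<open>M i = max {\<pi> 1, \<dots>, \<pi> i}\<close>, an interval \<open>[i, j]\<close> lies outside the ideal
  generated by \<open>Exc \<pi>\<close> iff \<open>M i \<le> j\<close>, so rowmotion of \<open>Exc \<pi>\<close> consists of the intervals
  \<open>[i, M i]\<close> with \<open>M i < M (i + 1)\<close>: one for each left-to-right maximum except the first.
  Counting weak excedances therefore gives \<open>fp \<pi> + |Exc \<pi>| = 1 + |Exc (\<rho> \<pi>)|\<close>, and the sum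
  over an orbit telescopes.
\<close>

section \<open>Antichain rowmotion on a finite poset of sets\<close>

lemma antichain_rowmotion_in_antichains: "antichain_rowmotion P A \<in> antichains P"
  by (auto simp: antichain_rowmotion_def minimal_elements_def antichains_def)

text \<open>By finiteness, every element outside the ideal lies above a minimal such element. So the
  complement of the ideal is the up-set generated by the rowmotion image, which therefore determines
  the ideal.\<close>

lemma order_ideal_eq_compl_rowmotion:
  assumes "finite P"
  shows "order_ideal P A = {x \<in> P. \<not> (\<exists>m\<in>antichain_rowmotion P A. m \<subseteq> x)}"
proof -
  have fin: "finite (P - order_ideal P A)" using assms by simp
  have ex: "\<exists>m\<in>antichain_rowmotion P A. m \<subseteq> x" if x: "x \<in> P" "x \<notin> order_ideal P A" for x
  proof -
    have "x \<in> P - order_ideal P A" using x by simp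
    from finite_has_minimal2[OF fin this] obtain m where m: "m \<in> P - order_ideal P A"
      "m \<subseteq> x \<and> (\<forall>b\<in>P - order_ideal P A. b \<subseteq> m \<longrightarrow> m = b)" by (rule bexE)
    have "m \<in> antichain_rowmotion P A"
      unfolding antichain_rowmotion_def minimal_elements_def
    proof (intro CollectI conjI ballI impI)
      show "m \<in> P - order_ideal P A" by (rule m(1))
      show "y = m" if "y \<in> P - order_ideal P A" "y \<subseteq> m" for y
        using conjunct2[OF m(2), rule_format, OF that] by (rule sym)
    qed
    then show ?thesis using m(2) by (intro bexI) (rule conjunct1)
  qed
  have outside: "antichain_rowmotion P A \<subseteq> P - order_ideal P A"
    unfolding antichain_rowmotion_def minimal_elements_def by (rule Collect_restrict)
  have down: "m \<in> order_ideal P A" if "x \<in> order_ideal P A" "m \<in> P" "m \<subseteq> x" for m x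
  proof -
    obtain y where "y \<in> A" "x \<subseteq> y" using \<open>x \<in> order_ideal P A\<close> by (auto simp: order_ideal_def)
    then show ?thesis using that by (auto simp: order_ideal_def)
  qed
  have sub: "order_ideal P A \<subseteq> P" by (auto simp: order_ideal_def)
  show ?thesis
  proof (intro equalityI subsetI CollectI conjI notI)
    fix x assume x: "x \<in> order_ideal P A"
    then show "x \<in> P" using sub by (rule subsetD[rotated])
    assume "\<exists>m\<in>antichain_rowmotion P A. m \<subseteq> x"
    then obtain m where "m \<in> antichain_rowmotion P A" "m \<subseteq> x" by (elim bexE)
    then show False using down[OF x _ \<open>m \<subseteq> x\<close>] subsetD[OF outside, of m] by simp
  next
    fix x assume "x \<in> {x \<in> P. \<not> (\<exists>m\<in>antichain_rowmotion P A. m \<subseteq> x)}"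
    then show "x \<in> order_ideal P A" using ex[of x] by (cases "x \<in> order_ideal P A") simp_all
  qed
qed

text \<open>Lets an antichain be recovered from its ideal: anything in the ideal above
  \<open>x \<in> A\<close> lies below some \<open>z \<in> A\<close>, and then
  \<open>x = z\<close>.\<close>

lemma antichain_eq_maximal_order_ideal:
  assumes "A \<in> antichains P"
  shows "A = {x \<in> order_ideal P A. \<forall>y\<in>order_ideal P A. x \<subseteq> y \<longrightarrow> x = y}" (is "A = ?R")
proof (intro equalityI subsetI)
  have AP: "A \<subseteq> P" and anti: "\<And>x y. x \<in> A \<Longrightarrow> y \<in> A \<Longrightarrow> x \<subseteq> y \<Longrightarrow> x = y"
    using assms by (auto simp: antichains_def)
  have sub: "x \<in> order_ideal P A" if "x \<in> A" for x
    using that AP by (auto simp: order_ideal_def)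
  show "x \<in> ?R" if x: "x \<in> A" for x
  proof (intro CollectI conjI ballI impI)
    show "x \<in> order_ideal P A" by (rule sub[OF x])
    fix y assume "y \<in> order_ideal P A" "x \<subseteq> y"
    then obtain z where z: "z \<in> A" "y \<subseteq> z" by (auto simp: order_ideal_def)
    then have "x = z" using anti[OF x z(1)] \<open>x \<subseteq> y\<close> by simp
    then show "x = y" using \<open>x \<subseteq> y\<close> z(2) by simp
  qed
  show "x \<in> A" if x: "x \<in> ?R" for x
  proof -
    obtain y where y: "y \<in> A" "x \<subseteq> y" using x by (auto simp: order_ideal_def)
    then have "x = y" using x sub by simp
    then show ?thesis using y by simp
  qed
qed

lemma inj_on_antichain_rowmotion:
  assumes "finite P"
  shows "inj_on (antichain_rowmotion P) (antichains P)"
proof (rule inj_onI)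
  fix A B
  assume AB: "A \<in> antichains P" "B \<in> antichains P"
    and eq: "antichain_rowmotion P A = antichain_rowmotion P B"
  have ideal: "order_ideal P A = order_ideal P B"
    unfolding order_ideal_eq_compl_rowmotion[OF assms] eq by (rule refl)
  show "A = B"
    using antichain_eq_maximal_order_ideal[OF AB(1)] antichain_eq_maximal_order_ideal[OF AB(2)]
    unfolding ideal by (rule trans[OF _ sym])
qed

lemma finite_root_poset: "finite (root_poset m)"
  by (rule finite_subset[of _ "Pow {1..m}"]) (auto simp: root_poset_def)

section \<open>Excedances of 321-avoiding permutations\<close>

text \<open>Each of the values \<open>1, ..., m - 1\<close> is attained exactly once. This count
  drives the pigeonhole arguments below.\<close>

lemma permutes_card_less:
  fixes \<pi> :: "nat \<Rightarrow> nat"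
  assumes "\<pi> permutes {1..n}" "m \<le> n + 1"
  shows "card {k \<in> {1..n}. \<pi> k < m} = m - 1"
proof -
  have "\<pi> ` {k \<in> {1..n}. \<pi> k < m} = {1..<m}"
  proof
    show "\<pi> ` {k \<in> {1..n}. \<pi> k < m} \<subseteq> {1..<m}"
    proof
      fix v assume "v \<in> \<pi> ` {k \<in> {1..n}. \<pi> k < m}"
      then obtain k where "k \<in> {1..n}" "\<pi> k < m" "v = \<pi> k" by blast
      then show "v \<in> {1..<m}" using permutes_in_image[OF assms(1), of k] by simp
    qed
    show "{1..<m} \<subseteq> \<pi> ` {k \<in> {1..n}. \<pi> k < m}"
    proof
      fix v assume v: "v \<in> {1..<m}"
      then have "v \<in> \<pi> ` {1..n}" using permutes_image[OF assms(1)] assms(2) by auto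
      then show "v \<in> \<pi> ` {k \<in> {1..n}. \<pi> k < m}" using v by auto
    qed
  qed
  moreover have "inj_on \<pi> {k \<in> {1..n}. \<pi> k < m}"
    using permutes_inj[OF assms(1)] inj_on_subset by blast
  ultimately show ?thesis by (metis card_image card_atLeastLessThan)
qed

lemma S321_range:
  assumes "\<pi> \<in> S321 n" "i \<in> {1..n}"
  shows "1 \<le> \<pi> i" "\<pi> i \<le> n"
  using assms permutes_in_image[of \<pi> "{1..n}" i] by (auto simp: S321_def)

lemma S321_eq_iff:
  assumes "\<pi> \<in> S321 n"
  shows "\<pi> i = \<pi> j \<longleftrightarrow> i = j"
  using assms permutes_inj[of \<pi> "{1..n}"] by (auto simp: S321_def inj_eq)

lemma S321_card_less:
  assumes "\<pi> \<in> S321 n" "m \<le> n + 1"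
  shows "card {k \<in> {1..n}. \<pi> k < m} = m - 1"
  using assms permutes_card_less by (auto simp: S321_def)

lemma S321D:
  assumes "\<pi> \<in> S321 n" "1 \<le> i" "i < j" "j < k" "k \<le> n" "\<pi> j < \<pi> i" "\<pi> k < \<pi> j"
  shows False
  using assms by (force simp: S321_def avoids_321_def)

text \<open>If \<open>\<pi> i > \<pi> j\<close>, avoiding 321 forces every value after
  \<open>j\<close> above \<open>\<pi> j\<close>. The \<open>\<pi> j - 1\<close> smaller values then
  fit into the \<open>j - 2\<close> positions before \<open>j\<close> other than \<open>i\<close>,
  so \<open>\<pi> j < j\<close>.\<close>

lemma weak_excedance_left_to_right_max:
  assumes "\<pi> \<in> S321 n" "1 \<le> i" "i < j" "j \<le> n" "j \<le> \<pi> j"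
  shows "\<pi> i < \<pi> j"
proof (rule ccontr)
  assume "\<not> \<pi> i < \<pi> j"
  then have gt: "\<pi> j < \<pi> i" using S321_eq_iff[OF assms(1), of i j] assms by auto
  have "\<pi> j < \<pi> k" if "k \<in> {j<..n}" for k
    using S321D[OF assms(1), of i j k] that gt assms S321_eq_iff[OF assms(1), of j k] by force
  then have sub: "{k \<in> {1..n}. \<pi> k < \<pi> j} \<subseteq> {1..<j} - {i}"
    using gt by (auto simp: not_less) (metis not_less_iff_gr_or_eq greaterThanAtMost_iff)
  have "\<pi> j - 1 \<le> card ({1..<j} - {i})"
    using card_mono[OF _ sub] S321_card_less[OF assms(1), of "\<pi> j"] S321_range[OF assms(1), of j]
      assms by simp
  also have "\<dots> = j - 2" using assms by simp
  finally show False using assms by linarith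
qed

text \<open>Converse of the previous lemma: the \<open>j - 1\<close> earlier positions all carry
  values below \<open>\<pi> j\<close>.\<close>

lemma left_to_right_max_weak_excedance:
  assumes "\<pi> \<in> S321 n" "j \<in> {1..n}" "\<And>i. i \<in> {1..<j} \<Longrightarrow> \<pi> i < \<pi> j"
  shows "j \<le> \<pi> j"
proof -
  have "{1..<j} \<subseteq> {k \<in> {1..n}. \<pi> k < \<pi> j}" using assms by auto
  then have "card {1..<j} \<le> card {k \<in> {1..n}. \<pi> k < \<pi> j}" by (intro card_mono) auto
  then show ?thesis
    using S321_card_less[OF assms(1), of "\<pi> j"] S321_range[OF assms(1,2)] assms(2) by simp
qed

text \<open>Dual pigeonhole: if \<open>\<pi> j < \<pi> i\<close>, avoiding 321 puts all values
  before \<open>i\<close> below \<open>\<pi> i\<close>. Together with \<open>j\<close> this makes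
  \<open>i\<close> positions with values below \<open>\<pi> i\<close>, so
  \<open>i < \<pi> i\<close>.\<close>

lemma weak_deficiencies_increasing:
  assumes "\<pi> \<in> S321 n" "1 \<le> i" "i < j" "j \<le> n" "\<pi> i \<le> i"
  shows "\<pi> i < \<pi> j"
proof (rule ccontr)
  assume "\<not> \<pi> i < \<pi> j"
  then have gt: "\<pi> j < \<pi> i" using S321_eq_iff[OF assms(1), of i j] assms by auto
  have "\<pi> k < \<pi> i" if "k \<in> {1..<i}" for k
    using S321D[OF assms(1), of k i j] that gt assms S321_eq_iff[OF assms(1), of k i] by force
  then have sub: "insert j {1..<i} \<subseteq> {k \<in> {1..n}. \<pi> k < \<pi> i}"
    using gt assms by auto
  have "card (insert j {1..<i}) \<le> \<pi> i - 1"
    using card_mono[OF _ sub] S321_card_less[OF assms(1), of "\<pi> i"] S321_range[OF assms(1), of i]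
      assms by simp
  moreover have "card (insert j {1..<i}) = i" using assms by simp
  ultimately show False using assms by linarith
qed

section \<open>The excedance map into antichains of intervals\<close>

lemma Exc_eq_image: "Exc n \<pi> = (\<lambda>i. {i..\<pi> i - 1}) ` {i \<in> {1..n}. i < \<pi> i}"
  by (auto simp: Exc_def)

lemma atLeastAtMost_mem_Exc:
  assumes "i \<le> j"
  shows "{i..j} \<in> Exc n \<pi> \<longleftrightarrow> i \<in> {1..n} \<and> \<pi> i = Suc j"
  using assms by (auto simp: Exc_def Icc_eq_Icc)

lemma card_Exc: "card (Exc n \<pi>) = card {i \<in> {1..n}. i < \<pi> i}"
  unfolding Exc_eq_image by (rule card_image) (auto simp: inj_on_def Icc_eq_Icc)

text \<open>Nested intervals would give excedances \<open>j \<le> i\<close> with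
  \<open>\<pi> i \<le> \<pi> j\<close>; as excedances are left-to-right maxima, this forces
  \<open>i = j\<close>.\<close>

lemma Exc_in_antichains:
  assumes "\<pi> \<in> S321 n"
  shows "Exc n \<pi> \<in> antichains (root_poset (n - 1))"
proof -
  have "Exc n \<pi> \<subseteq> root_poset (n - 1)"
  proof
    fix x assume "x \<in> Exc n \<pi>"
    then obtain i where i: "i \<in> {1..n}" "i < \<pi> i" "x = {i..\<pi> i - 1}" by (auto simp: Exc_def)
    then show "x \<in> root_poset (n - 1)"
      using S321_range[OF assms i(1)] unfolding root_poset_def by fastforce
  qed
  moreover have "x = y" if "x \<in> Exc n \<pi>" "y \<in> Exc n \<pi>" "x \<subseteq> y" for x y
  proof -
    obtain i j where i: "i \<in> {1..n}" "i < \<pi> i" "x = {i..\<pi> i - 1}"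
      and j: "j \<in> {1..n}" "j < \<pi> j" "y = {j..\<pi> j - 1}"
      using \<open>x \<in> Exc n \<pi>\<close> \<open>y \<in> Exc n \<pi>\<close> by (auto simp: Exc_def)
    have "j \<le> i" "\<pi> i \<le> \<pi> j" using \<open>x \<subseteq> y\<close> i j by auto
    then have "i = j"
      using weak_excedance_left_to_right_max[OF assms, of j i] i j by force
    then show ?thesis using i j by simp
  qed
  ultimately show ?thesis unfolding antichains_def by blast
qed

text \<open>
  At the first disagreement both permutations are weakly deficient, so the smaller of the two
  values has no later position available in the other permutation.
\<close>

lemma inj_on_Exc: "inj_on (Exc n) (S321 n)"
proof (rule inj_onI)
  fix \<pi> \<sigma> assume pi: "\<pi> \<in> S321 n" and sg: "\<sigma> \<in> S321 n" and eq: "Exc n \<pi> = Exc n \<sigma>"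
  \<comment> \<open>Stated for fresh \<open>\<pi>\<close> and \<open>\<tau>\<close>, since it is
    applied in both directions; likewise \<open>first\<close> below.\<close>
  have exc_eq: "\<tau> i = \<pi> i" if "Exc n \<pi> = Exc n \<tau>" "i \<in> {1..n}" "i < \<pi> i" for i \<pi> \<tau>
  proof -
    have "{i..\<pi> i - 1} \<in> Exc n \<tau>"
      using that atLeastAtMost_mem_Exc[of i "\<pi> i - 1" n \<pi>] by auto
    then show ?thesis using that atLeastAtMost_mem_Exc[of i "\<pi> i - 1" n \<tau>] by auto
  qed
  have exc: "\<pi> i = \<sigma> i" if "i \<in> {1..n}" "i < \<pi> i \<or> i < \<sigma> i" for i
    using that exc_eq[OF eq, of i] exc_eq[OF eq[symmetric], of i] by auto
  have first: False
    if "\<sigma> \<in> S321 n" "\<pi> \<in> S321 n" "i \<in> {1..n}" "\<pi> i < \<sigma> i" "\<sigma> i \<le> i"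
      "\<And>k. k \<in> {1..<i} \<Longrightarrow> \<pi> k = \<sigma> k" for i \<pi> \<sigma>
  proof -
    have "\<pi> i \<in> \<sigma> ` {1..n}"
      using S321_range[OF that(2,3)] permutes_image[of \<sigma> "{1..n}"] that(1)
      by (auto simp: S321_def)
    then obtain p where p: "p \<in> {1..n}" "\<sigma> p = \<pi> i" by auto
    have "\<not> p < i" using that(6)[of p] p S321_eq_iff[OF that(2), of p i] by auto
    moreover have "p \<noteq> i" using p that(4) by auto
    ultimately show False
      using weak_deficiencies_increasing[OF that(1), of i p] that p by auto
  qed
  have "\<pi> i = \<sigma> i" if "i \<in> {1..n}" for i
    using that
  proof (induction i rule: less_induct)
    case (less i)
    then have prev: "\<And>k. k \<in> {1..<i} \<Longrightarrow> \<pi> k = \<sigma> k" by auto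
    show ?case
    proof (cases "i < \<pi> i \<or> i < \<sigma> i")
      case False
      then show ?thesis
        using first[OF sg pi less.prems _ _ prev] first[OF pi sg less.prems _ _ prev[symmetric]]
        by (meson linorder_neqE_nat not_less)
    qed (use exc less.prems in blast)
  qed
  moreover have "\<pi> i = \<sigma> i" if "i \<notin> {1..n}" for i
    using pi sg that permutes_not_in[of \<pi> "{1..n}" i] permutes_not_in[of \<sigma> "{1..n}" i]
    by (simp add: S321_def)
  ultimately show "\<pi> = \<sigma>" by blast
qed

text \<open>Compose the inverse of the increasing enumeration of \<open>A\<close> with that of
  \<open>B\<close>. This will place the values at the non-excedances.\<close>

lemma strict_mono_on_bij_betw_exists:
  fixes A B :: "nat set"
  assumes "finite A" "finite B" "card A = card B"
  obtains h where "bij_betw h A B" "strict_mono_on A h"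
proof -
  obtain a where a: "bij_betw a {..<card A} A" "strict_mono_on {..<card A} a"
    using ex_bij_betw_strict_mono_card[OF assms(1)] by blast
  obtain b where b: "bij_betw b {..<card A} B" "strict_mono_on {..<card A} b"
    using ex_bij_betw_strict_mono_card[OF assms(2)] assms(3) by metis
  let ?c = "inv_into {..<card A} a"
  have c: "bij_betw ?c A {..<card A}" using bij_betw_inv_into[OF a(1)] .
  have "strict_mono_on A (b \<circ> ?c)"
  proof (rule strict_mono_onI)
    fix x y assume xy: "x \<in> A" "y \<in> A" "x < y"
    have in_c: "?c x \<in> {..<card A}" "?c y \<in> {..<card A}" using bij_betw_apply[OF c] xy by blast+
    have "a (?c x) = x" "a (?c y) = y" using bij_betw_inv_into_right[OF a(1)] xy by blast+
    then have "?c x < ?c y"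
      using in_c xy(3) strict_mono_on_less[OF a(2)] by metis
    then show "(b \<circ> ?c) x < (b \<circ> ?c) y" using strict_mono_onD[OF b(2)] in_c by simp
  qed
  then show thesis using that bij_betw_trans[OF c b(1)] by blast
qed

text \<open>
  The excedances are prescribed by the antichain and the remaining values are placed in
  increasing order.
\<close>

lemma antichains_subset_Exc_image:
  assumes "A \<in> antichains (root_poset (n - 1))"
  shows "A \<in> Exc n ` S321 n"
proof -
  \<comment> \<open>\<open>E\<close> is the set of prescribed excedance positions, the left
    endpoints of \<open>A\<close>. The prescribed value \<open>g i\<close> is one more than the
    right endpoint, which is unique because \<open>A\<close> is an antichain.\<close>
  define E where "E = {i. \<exists>j. i \<le> j \<and> {i..j} \<in> A}"
  define g where "g i = (THE v. i < v \<and> {i..v - 1} \<in> A)" for i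
  have bounds: "1 \<le> i" "j \<le> n - 1" if "{i..j} \<in> A" "i \<le> j" for i j
    using assms that by (auto simp: antichains_def root_poset_def Icc_eq_Icc)
  have anti: "i = i' \<and> j = j'"
    if "{i..j} \<in> A" "{i'..j'} \<in> A" "i \<le> j" "i' \<le> i" "j \<le> j'" for i j i' j'
  proof -
    have "x = y" if "x \<in> A" "y \<in> A" "x \<subseteq> y" for x y
      using assms that by (auto simp: antichains_def)
    moreover have "{i..j} \<subseteq> {i'..j'}" using that by auto
    ultimately have "{i..j} = {i'..j'}" using that(1,2) by blast
    then show ?thesis using that by (simp add: Icc_eq_Icc)
  qed
  have g: "i < g i" "{i..g i - 1} \<in> A" if i: "i \<in> E" for i
  proof -
    obtain j where j: "i \<le> j" "{i..j} \<in> A" using i by (auto simp: E_def)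
    have "v = Suc j" if "i < v" "{i..v - 1} \<in> A" for v
      using anti[of i j i "v - 1"] anti[of i "v - 1" i j] that j by fastforce
    then have "\<exists>!v. i < v \<and> {i..v - 1} \<in> A"
      using j by (intro ex1I[of _ "Suc j"]) auto
    from theI'[OF this] show "i < g i" "{i..g i - 1} \<in> A" by (auto simp: g_def)
  qed
  have g_eq: "i \<in> E \<and> g i = Suc j" if "{i..j} \<in> A" "i \<le> j" for i j
  proof -
    have "i \<in> E" using that by (auto simp: E_def)
    then show ?thesis
      using g[of i] that anti[of i j i "g i - 1"] anti[of i "g i - 1" i j] by fastforce
  qed
  have E_sub: "E \<subseteq> {1..n}" and g_sub: "g ` E \<subseteq> {1..n}"
    using bounds g by (fastforce simp: E_def)+
  \<comment> \<open>An interval that starts later but does not end later would be nested in the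
    earlier one.\<close>
  have g_mono: "strict_mono_on E g"
  proof (rule strict_mono_onI, rule ccontr)
    fix i j assume ij: "i \<in> E" "j \<in> E" "i < j" "\<not> g i < g j"
    then show False
      using anti[of j "g j - 1" i "g i - 1"] g[of i] g[of j] by fastforce
  qed
  have g_bij: "bij_betw g E (g ` E)"
    using strict_mono_on_imp_inj_on[OF g_mono] by (rule inj_on_imp_bij_betw)
  have "card ({1..n} - E) = card ({1..n} - g ` E)"
    using E_sub g_sub bij_betw_same_card[OF g_bij] finite_subset[OF E_sub]
    by (simp add: card_Diff_subset)
  then obtain h where h: "bij_betw h ({1..n} - E) ({1..n} - g ` E)"
    and h_mono: "strict_mono_on ({1..n} - E) h"
    using strict_mono_on_bij_betw_exists[of "{1..n} - E" "{1..n} - g ` E"] by auto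
  define \<pi> where "\<pi> i = (if i \<in> E then g i else if i \<in> {1..n} then h i else i)" for i
  have "bij_betw (\<lambda>i. if i \<in> E then g i else h i) (E \<union> ({1..n} - E)) (g ` E \<union> ({1..n} - g ` E))"
    by (rule bij_betw_disjoint_Un[OF g_bij h]) auto
  then have "bij_betw (\<lambda>i. if i \<in> E then g i else h i) {1..n} {1..n}"
    using E_sub g_sub by (simp add: Un_absorb1)
  then have "bij_betw \<pi> {1..n} {1..n}"
    by (rule bij_betw_cong[THEN iffD1, rotated]) (auto simp: \<pi>_def)
  then have perm: "\<pi> permutes {1..n}"
    by (rule bij_imp_permutes) (use E_sub in \<open>auto simp: \<pi>_def\<close>)
  have mono_E: "\<pi> i < \<pi> j" if "i \<in> E" "j \<in> E" "i < j" for i j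
    using strict_mono_onD[OF g_mono that] that by (simp add: \<pi>_def)
  have mono_compl: "\<pi> i < \<pi> j" if "i \<in> {1..n} - E" "j \<in> {1..n} - E" "i < j" for i j
    using strict_mono_onD[OF h_mono that] that by (simp add: \<pi>_def)
  \<comment> \<open>Two of any three positions lie both in \<open>E\<close> or both outside it, and
    \<open>\<pi>\<close> increases on each of these two classes.\<close>
  have "avoids_321 n \<pi>"
    unfolding avoids_321_def
  proof safe
    fix i j k
    assume *: "i \<in> {1..n}" "j \<in> {1..n}" "k \<in> {1..n}" "i < j" "j < k" "\<pi> j < \<pi> i" "\<pi> k < \<pi> j"
    have "\<pi> k < \<pi> i" using * by simp
    then show False
      using * mono_E[of i j] mono_E[of j k] mono_E[of i k]
        mono_compl[of i j] mono_compl[of j k] mono_compl[of i k]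
      by (metis DiffI less_trans less_asym)
  qed
  then have S: "\<pi> \<in> S321 n" using perm by (simp add: S321_def)
  \<comment> \<open>Rules out unwanted excedances. If \<open>p < \<pi> p\<close>, every
    \<open>k\<close> with \<open>\<pi> k \<le> p\<close> lies before \<open>p\<close>: for
    \<open>k \<in> E\<close> because \<open>k < g k\<close>, otherwise by monotonicity. So
    \<open>p\<close> values would share \<open>p - 1\<close> positions.\<close>
  have deficient: "\<pi> p \<le> p" if p: "p \<in> {1..n} - E" for p
  proof (rule ccontr)
    assume "\<not> \<pi> p \<le> p"
    then have gt: "p < \<pi> p" by simp
    have "k < p" if "k \<in> {1..n}" "\<pi> k < Suc p" for k
    proof (cases "k \<in> E")
      case True
      then show ?thesis using g(1)[of k] that by (simp add: \<pi>_def)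
    next
      case False
      then show ?thesis using mono_compl[of p k] that p gt by (metis DiffI less_Suc_eq
            linorder_neqE_nat not_less_eq less_trans)
    qed
    then have "{k \<in> {1..n}. \<pi> k < Suc p} \<subseteq> {1..<p}" by auto
    then have "card {k \<in> {1..n}. \<pi> k < Suc p} \<le> card {1..<p}" by (intro card_mono) auto
    then show False using S321_card_less[OF S, of "Suc p"] p by auto
  qed
  have "Exc n \<pi> = A"
  proof
    show "Exc n \<pi> \<subseteq> A"
    proof
      fix x assume "x \<in> Exc n \<pi>"
      then obtain i where i: "i \<in> {1..n}" "i < \<pi> i" "x = {i..\<pi> i - 1}" by (auto simp: Exc_def)
      then have "i \<in> E" using deficient[of i] by force
      then show "x \<in> A" using g i by (simp add: \<pi>_def)
    qed
    show "A \<subseteq> Exc n \<pi>"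
    proof
      fix x assume x: "x \<in> A"
      then obtain i j where ij: "x = {i..j}" "i \<le> j"
        using assms by (auto simp: antichains_def root_poset_def)
      then have "i \<in> E" "g i = Suc j" using g_eq x by blast+
      then show "x \<in> Exc n \<pi>" using ij E_sub by (auto simp: atLeastAtMost_mem_Exc \<pi>_def)
    qed
  qed
  then show ?thesis using S by blast
qed

section \<open>Rowmotion in terms of left-to-right maxima\<close>

text \<open>At \<open>i = 0\<close> this is the unspecified maximum of the empty set, so the facts
  below concern \<open>i \<ge> 1\<close>.\<close>

definition running_max :: "(nat \<Rightarrow> nat) \<Rightarrow> nat \<Rightarrow> nat" where
  "running_max \<pi> i = Max (\<pi> ` {1..i})"

lemma running_max_le_iff:
  assumes "1 \<le> i"
  shows "running_max \<pi> i \<le> m \<longleftrightarrow> (\<forall>k\<in>{1..i}. \<pi> k \<le> m)"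
  using assms by (auto simp: running_max_def)

lemma running_max_Suc:
  assumes "1 \<le> i"
  shows "running_max \<pi> (Suc i) = max (\<pi> (Suc i)) (running_max \<pi> i)"
  using assms by (auto simp: running_max_def atLeastAtMostSuc_conv)

text \<open>Only \<open>i - 1\<close> values lie below \<open>i\<close>, too few for the first
  \<open>i\<close> positions. This keeps the intervals \<open>{i..running_max \<pi> i}\<close>
  nonempty.\<close>

lemma running_max_ge:
  assumes "\<pi> \<in> S321 n" "i \<in> {1..n}"
  shows "i \<le> running_max \<pi> i"
proof (rule ccontr)
  assume "\<not> i \<le> running_max \<pi> i"
  then have "{1..i} \<subseteq> {k \<in> {1..n}. \<pi> k < i}"
    using assms(2) running_max_le_iff[of i \<pi> "i - 1"] by fastforce
  then have "card {1..i} \<le> card {k \<in> {1..n}. \<pi> k < i}" by (intro card_mono) auto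
  then show False using S321_card_less[OF assms(1), of i] assms(2) by auto
qed

text \<open>Containment in \<open>{k..\<pi> k - 1}\<close> means \<open>k \<le> i\<close> and
  \<open>j < \<pi> k\<close>. Since \<open>i \<le> j\<close>, any such \<open>k\<close> is
  automatically an excedance, so the maximum may run over all positions up to
  \<open>i\<close>.\<close>

lemma mem_order_ideal_Exc:
  assumes "1 \<le> i" "i \<le> j" "j \<le> n - 1"
  shows "{i..j} \<in> order_ideal (root_poset (n - 1)) (Exc n \<pi>) \<longleftrightarrow> j < running_max \<pi> i"
proof -
  have "{i..j} \<in> order_ideal (root_poset (n - 1)) (Exc n \<pi>) \<longleftrightarrow> (\<exists>y\<in>Exc n \<pi>. {i..j} \<subseteq> y)"
    using assms by (auto simp: order_ideal_def root_poset_def)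
  also have "\<dots> \<longleftrightarrow> (\<exists>k\<in>{1..i}. j < \<pi> k)"
  proof
    assume "\<exists>y\<in>Exc n \<pi>. {i..j} \<subseteq> y"
    then obtain k where k: "k \<in> {1..n}" "k < \<pi> k" "{i..j} \<subseteq> {k..\<pi> k - 1}"
      by (auto simp: Exc_def)
    then have "k \<le> i" "j \<le> \<pi> k - 1" using assms by auto
    then show "\<exists>k\<in>{1..i}. j < \<pi> k" using k(1,2) by (intro bexI[of _ k]) auto
  next
    assume "\<exists>k\<in>{1..i}. j < \<pi> k"
    then obtain k where "k \<in> {1..i}" "j < \<pi> k" by blast
    then show "\<exists>y\<in>Exc n \<pi>. {i..j} \<subseteq> y"
      using assms by (intro bexI[of _ "{k..\<pi> k - 1}"]) (auto simp: Exc_def)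
  qed
  also have "\<dots> \<longleftrightarrow> j < running_max \<pi> i"
    using running_max_le_iff[OF assms(1), of \<pi> j] by (auto simp: not_le[symmetric])
  finally show ?thesis .
qed

text \<open>An interval outside the ideal can be shortened on the right until it ends at
  \<open>running_max \<pi> i\<close>. Shortening on the left is then blocked exactly when the
  running maximum increases at \<open>Suc i\<close>.\<close>

lemma rowmotion_Exc_eq:
  assumes "\<pi> \<in> S321 n"
  shows "antichain_rowmotion (root_poset (n - 1)) (Exc n \<pi>) =
    (\<lambda>i. {i..running_max \<pi> i}) ` {i \<in> {1..<n}. running_max \<pi> i < running_max \<pi> (Suc i)}"
    (is "?L = ?f ` ?S")
proof -
  let ?M = "running_max \<pi>"
  let ?U = "root_poset (n - 1) - order_ideal (root_poset (n - 1)) (Exc n \<pi>)"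
  have U: "{i..j} \<in> ?U \<longleftrightarrow> 1 \<le> i \<and> j \<le> n - 1 \<and> ?M i \<le> j" if "i \<le> j" for i j
    using that mem_order_ideal_Exc[of i j n \<pi>]
    by (auto simp: root_poset_def Icc_eq_Icc)
  have U_form: "\<exists>i j. y = {i..j} \<and> i \<le> j" if "y \<in> ?U" for y
    using that by (auto simp: root_poset_def)
  have M_ge: "i \<le> ?M i" if "1 \<le> i" "i \<le> n" for i
    using running_max_ge[OF assms] that by simp
  have M_mono: "?M i \<le> ?M k" if "1 \<le> i" "i \<le> k" for i k
    using that running_max_le_iff[of i \<pi> "?M k"] running_max_le_iff[of k \<pi> "?M k"] by auto
  show ?thesis
  proof
    show "?L \<subseteq> ?f ` ?S"
    proof
      fix x assume x: "x \<in> ?L"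
      then have xU: "x \<in> ?U" and min: "\<And>y. y \<in> ?U \<Longrightarrow> y \<subseteq> x \<Longrightarrow> y = x"
        by (auto simp: antichain_rowmotion_def minimal_elements_def)
      obtain i j where ij: "x = {i..j}" "i \<le> j" using U_form[OF xU] by blast
      have b: "1 \<le> i" "j \<le> n - 1" "?M i \<le> j" using U ij xU by auto
      have "?M i = j"
      proof (rule ccontr)
        assume "?M i \<noteq> j"
        moreover have "i \<le> ?M i" using b M_ge[of i] ij by linarith
        ultimately have "i \<le> j - 1" "?M i \<le> j - 1" using b by linarith+
        then show False
          using min[of "{i..j - 1}"] U[of i "j - 1"] b ij by (auto simp: Icc_eq_Icc)
      qed
      moreover have "j < ?M (Suc i)"
      proof (rule ccontr)
        assume "\<not> j < ?M (Suc i)"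
        \<comment> \<open>The shortened interval is nonempty, hence a genuine competitor to
          \<open>x\<close>.\<close>
        moreover from this have "Suc i \<le> j" using M_ge[of "Suc i"] b ij by linarith
        ultimately show False
          using min[of "{Suc i..j}"] U[of "Suc i" j] b ij by (auto simp: Icc_eq_Icc)
      qed
      ultimately show "x \<in> ?f ` ?S" using ij b by auto
    qed
    show "?f ` ?S \<subseteq> ?L"
    proof
      fix x assume "x \<in> ?f ` ?S"
      then obtain i where i: "i \<in> {1..<n}" "?M i < ?M (Suc i)" "x = {i..?M i}" by blast
      \<comment> \<open>Together with the strict increase this gives
        \<open>?M i \<le> n - 1\<close>, so the interval lies in the poset.\<close>
      have "?M (Suc i) \<le> n"
        using running_max_le_iff[of "Suc i" \<pi> n] S321_range(2)[OF assms] i by auto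
      then have xU: "x \<in> ?U" using U[of i "?M i"] M_ge[of i] i by auto
      have "y = x" if y: "y \<in> ?U" "y \<subseteq> x" for y
      proof -
        obtain k l where kl: "y = {k..l}" "k \<le> l" using U_form[OF y(1)] by blast
        have b: "1 \<le> k" "?M k \<le> l" using U kl y(1) by auto
        have kb: "i \<le> k" "l \<le> ?M i" using y(2) kl i by auto
        \<comment> \<open>Otherwise
          \<open>?M i < ?M (Suc i) \<le> ?M k \<le> l \<le> ?M i\<close>.\<close>
        have "k = i"
          using M_mono[of "Suc i" k] kb b i by (metis Suc_leI le_antisym le_trans not_le
              le_eq_less_or_eq le_add1 plus_1_eq_Suc)
        then show ?thesis using kb b kl i by auto
      qed
      then show "x \<in> ?L" using xU by (auto simp: antichain_rowmotion_def minimal_elements_def)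
    qed
  qed
qed

text \<open>Both sides say that position \<open>Suc i\<close> is a left-to-right maximum.\<close>

lemma running_max_increases_iff:
  assumes "\<pi> \<in> S321 n" "i \<in> {1..<n}"
  shows "running_max \<pi> i < running_max \<pi> (Suc i) \<longleftrightarrow> Suc i \<le> \<pi> (Suc i)"
proof -
  have "running_max \<pi> i < running_max \<pi> (Suc i) \<longleftrightarrow> running_max \<pi> i < \<pi> (Suc i)"
    using assms(2) by (simp add: running_max_Suc less_max_iff_disj)
  also have "\<dots> \<longleftrightarrow> (\<forall>k\<in>{1..i}. \<pi> k < \<pi> (Suc i))"
    using assms(2) by (simp add: running_max_def)
  also have "\<dots> \<longleftrightarrow> Suc i \<le> \<pi> (Suc i)"
    using left_to_right_max_weak_excedance[OF assms(1), of "Suc i"]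
      weak_excedance_left_to_right_max[OF assms(1), of _ "Suc i"] assms(2) by auto
  finally show ?thesis .
qed

text \<open>Shifting \<open>i\<close> to \<open>Suc i\<close> matches the intervals with the weak
  excedances after position 1. Position 1 is always a weak excedance and accounts for the extra
  1.\<close>

lemma card_rowmotion_Exc:
  assumes "\<pi> \<in> S321 n" "1 \<le> n"
  shows "card (antichain_rowmotion (root_poset (n - 1)) (Exc n \<pi>)) + 1 =
    card {i \<in> {1..n}. i \<le> \<pi> i}"
proof -
  let ?S = "{i \<in> {1..<n}. running_max \<pi> i < running_max \<pi> (Suc i)}"
  have "inj_on (\<lambda>i. {i..running_max \<pi> i}) ?S"
    using running_max_ge[OF assms(1)] by (auto simp: inj_on_def Icc_eq_Icc)
  then have "card (antichain_rowmotion (root_poset (n - 1)) (Exc n \<pi>)) = card ?S"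
    unfolding rowmotion_Exc_eq[OF assms(1)] by (rule card_image)
  also have "\<dots> = card (Suc ` ?S)" by (simp add: card_image)
  finally have "card (antichain_rowmotion (root_poset (n - 1)) (Exc n \<pi>)) + 1 =
      card (insert 1 (Suc ` ?S))"
    by (subst card_insert_disjoint) auto
  also have "insert 1 (Suc ` ?S) = {i \<in> {1..n}. i \<le> \<pi> i}"
  proof (intro set_eqI iffI)
    fix i assume "i \<in> insert 1 (Suc ` ?S)"
    then show "i \<in> {i \<in> {1..n}. i \<le> \<pi> i}"
      using running_max_increases_iff[OF assms(1)] S321_range[OF assms(1), of 1] assms(2) by auto
  next
    fix i assume i: "i \<in> {i \<in> {1..n}. i \<le> \<pi> i}"
    show "i \<in> insert 1 (Suc ` ?S)"
    proof (cases "i = 1")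
      case False
      then obtain k where "i = Suc k" "k \<in> {1..<n}" using i by (cases i) auto
      then show ?thesis using running_max_increases_iff[OF assms(1), of k] i by auto
    qed simp
  qed
  finally show ?thesis .
qed

section \<open>Transfer of rowmotion to permutations, and orbit averages\<close>

lemma Exc_rowmotion:
  "Exc n (rowmotion n \<pi>) = antichain_rowmotion (root_poset (n - 1)) (Exc n \<pi>)"
  unfolding rowmotion_def
  \<comment> \<open>Surjectivity of \<open>Exc n\<close> onto the antichains makes
    \<open>inv_into\<close> a right inverse here.\<close>
  by (rule f_inv_into_f[OF antichains_subset_Exc_image[OF antichain_rowmotion_in_antichains]])

lemma rowmotion_in_S321: "rowmotion n \<pi> \<in> S321 n"
  unfolding rowmotion_def
  by (intro inv_into_into antichains_subset_Exc_image antichain_rowmotion_in_antichains)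

lemma inj_on_rowmotion: "inj_on (rowmotion n) (S321 n)"
proof (rule inj_onI)
  fix \<pi> \<sigma> assume "\<pi> \<in> S321 n" "\<sigma> \<in> S321 n" "rowmotion n \<pi> = rowmotion n \<sigma>"
  then show "\<pi> = \<sigma>"
    by (metis Exc_rowmotion Exc_in_antichains inj_onD[OF inj_on_Exc]
        inj_onD[OF inj_on_antichain_rowmotion[OF finite_root_poset]])
qed

text \<open>Weak excedances are fixed points or excedances, and all but one of them become intervals
  under rowmotion. Thus \<open>fp\<close> differs from 1 by a coboundary.\<close>

lemma fp_plus_card_Exc:
  assumes "\<pi> \<in> S321 n" "1 \<le> n"
  shows "fp n \<pi> + card (Exc n \<pi>) = 1 + card (Exc n (rowmotion n \<pi>))"
proof -
  have "{i \<in> {1..n}. i \<le> \<pi> i} = {i \<in> {1..n}. \<pi> i = i} \<union> {i \<in> {1..n}. i < \<pi> i}" by auto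
  then have "card {i \<in> {1..n}. i \<le> \<pi> i} = fp n \<pi> + card (Exc n \<pi>)"
    unfolding fp_def card_Exc by (simp add: card_Un_disjoint disjoint_iff)
  then show ?thesis using card_rowmotion_Exc[OF assms] Exc_rowmotion by simp
qed

text \<open>Since \<open>f\<close> permutes each orbit, the sums of \<open>w (f x)\<close> and
  \<open>w x\<close> over it cancel.\<close>

lemma mesic_if_coboundary:
  fixes st w :: "'a \<Rightarrow> real"
  assumes "finite X" "f ` X \<subseteq> X" "inj_on f X"
    and st: "\<And>x. x \<in> X \<Longrightarrow> st x = c + w (f x) - w x"
  shows "mesic c st f X"
  unfolding mesic_def
proof
  fix Orb assume "Orb \<in> orbit f ` X"
  then obtain x where x: "x \<in> X" "Orb = orbit f x" by blast
  have "y \<in> X" if "y \<in> orbit f x" for y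
    using that by induction (use assms(2) x in auto)
  then have sub: "Orb \<subseteq> X" using x by blast
  then have fin: "finite Orb" using assms(1) finite_subset by blast
  have inj: "inj_on f Orb" using sub assms(3) inj_on_subset by blast
  \<comment> \<open>An injective self-map of a finite set is onto, so the orbit can be reindexed
    along \<open>f\<close>.\<close>
  have "f ` Orb \<subseteq> Orb" using x by (auto intro: orbit.step)
  then have "f ` Orb = Orb" using endo_inj_surj fin inj by blast
  then have "(\<Sum>y\<in>Orb. w (f y)) = (\<Sum>y\<in>Orb. w y)"
    using sum.reindex[OF inj, of w] by simp
  moreover have "(\<Sum>y\<in>Orb. st y) = (\<Sum>y\<in>Orb. c + w (f y) - w y)"
    using st sub by (intro sum.cong) auto
  ultimately have "(\<Sum>y\<in>Orb. st y) = c * real (card Orb)"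
    by (simp add: sum.distrib sum_subtractf)
  moreover have "card Orb \<noteq> 0" using fin x orbit.base[of f x] by auto
  ultimately show "(\<Sum>y\<in>Orb. st y) / real (card Orb) = c" by simp
qed

theorem theorem4p1:
  fixes n :: nat
  assumes "n \<ge> 1"
  shows "mesic 1 (\<lambda>\<pi>. real (fp n \<pi>)) (rowmotion n) (S321 n)"
proof (rule mesic_if_coboundary)
  show "finite (S321 n)"
    using finite_permutations[of "{1..n}"] by (auto simp: S321_def intro: finite_subset)
  show "rowmotion n ` S321 n \<subseteq> S321 n" using rowmotion_in_S321 by blast
  show "inj_on (rowmotion n) (S321 n)" by (rule inj_on_rowmotion)
  \<comment> \<open>The potential \<open>w\<close> is the number of excedances.\<close>
  show "real (fp n \<pi>) = 1 + real (card (Exc n (rowmotion n \<pi>))) - real (card (Exc n \<pi>))"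
    if "\<pi> \<in> S321 n" for \<pi>
    using fp_plus_card_Exc[OF that assms] by linarith
qed

end
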